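(* Let $\mathcal H:\mathbb R_+\to\mathbb R_+$ be continuous, invertible and increasing on $\mathbb R_+=(0,\infty)$, and suppose that $x\mapsto\frac1x\mathcal H(x)$ is increasing on $(0,1)$. Suppose there exist constants $T>0$ and $C>0$ such that for every non-identically zero initial data $(\varphi_0,\varphi_1)\in H_1\times H_{1/2}$ the solution $\varphi$ of $$\ddot\varphi(t)+A\varphi(t)=0,\qquad \varphi(0)=\varphi_0,\ \dot\varphi(0)=\varphi_1$$ satisfies $$\int_0^T\|B^*\dot\varphi(t)\|_U^2\,dt\ \ge\ C\,\|(\varphi_0,\varphi_1)\|^2_{H_1\times H_{1/2}}\,\mathcal H\left(\frac{\|(\varphi_0,\varphi_1)\|^2_{H_{1/2}\times H}}{\|(\varphi_0,\varphi_1)\|^2_{H_1\times H_{1/2}}}\right).$$ Then there exists a constant $C_1>0$ such that for all $t>0$ and all non-identically zero initial data $(w_0,w_1)\in H_1\times H_{1/2}$, the solution $w$ of $$\ddot w(t)+Aw(t)+BB^*\dot w(t)=0,\qquad w(0)=w_0,\ \dot w(0)=w_1$$ satisfies $$\|(w(t),\dot w(t))\|^2_{H_{1/2}\times H}\le C_1\,\mathcal H^{-1}\left(\frac{1}{1+t}\right)\|(w_0,w_1)\|^2_{H_1\times H_{1/2}}.$$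
   Context: $H$ is a Hilbert space with norm $\|\cdot\|_H$ and $A:\mathcal D(A)\subset H\to H$ is a self-adjoint, positive and boundedly invertible operator. For $\alpha\ge0$, $H_\alpha=\mathcal D(A^\alpha)$ with norm $\|z\|_\alpha=\|A^\alpha z\|_H$. $U$ is another Hilbert space, identified with its dual, and $B:U\to H$ is a bounded linear operator with adjoint $B^*$. Both evolution problems are well-posed in $H_{1/2}\times H$ (i.e. $(w,\dot w),(\varphi,\dot\varphi)\in C([0,\infty);H_{1/2}\times H)$) and in $H_1\times H_{1/2}$. *)

theory Defs
  imports "HOL-Analysis.Analysis"
begin

text \<open>
  Hilbert spaces are types of class \<open>{real_inner, complete_space}\<close>. This covers complex Hilbert
  spaces: with the inner product replaced by its real part, norms, limits, adjoints,
  self-adjointness, positivity and square roots of complex-linear operators are unchanged.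

  An unbounded operator is a pair of a domain \<open>D\<close> and a function \<open>A\<close>; the values of \<open>A\<close> outside
  \<open>D\<close> are irrelevant.
\<close>

definition linear_operator :: "'h::real_inner set \<Rightarrow> ('h \<Rightarrow> 'h) \<Rightarrow> bool" where
  "linear_operator D A \<longleftrightarrow> subspace D \<and>
     (\<forall>x\<in>D. \<forall>y\<in>D. A (x + y) = A x + A y) \<and> (\<forall>c. \<forall>x\<in>D. A (c *\<^sub>R x) = c *\<^sub>R A x)"

text \<open>The set of \<open>y\<close> below is the domain of the adjoint operator.\<close>

definition self_adjoint :: "'h::real_inner set \<Rightarrow> ('h \<Rightarrow> 'h) \<Rightarrow> bool" where
  "self_adjoint D A \<longleftrightarrow> linear_operator D A \<and> closure D = UNIV \<and>
     {y. \<exists>z. \<forall>x\<in>D. A x \<bullet> y = x \<bullet> z} = D \<and>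
     (\<forall>x\<in>D. \<forall>y\<in>D. A x \<bullet> y = x \<bullet> A y)"

text \<open>For a self-adjoint boundedly invertible operator this is equivalent to strict positivity
  on non-zero vectors.\<close>

definition positive_operator :: "'h::real_inner set \<Rightarrow> ('h \<Rightarrow> 'h) \<Rightarrow> bool" where
  "positive_operator D A \<longleftrightarrow> (\<forall>x\<in>D. 0 \<le> A x \<bullet> x)"

definition boundedly_invertible :: "'h::real_inner set \<Rightarrow> ('h \<Rightarrow> 'h) \<Rightarrow> bool" where
  "boundedly_invertible D A \<longleftrightarrow>
     (\<exists>R. bounded_linear R \<and> (\<forall>y. R y \<in> D \<and> A (R y) = y) \<and> (\<forall>x\<in>D. R (A x) = x))"

text \<open>\<open>(D', S)\<close> is the positive self-adjoint square root of \<open>(D, A)\<close>, which exists and is unique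
  for positive self-adjoint \<open>A\<close>. Thus \<open>S\<close> is \<open>A\<close> to the power one half, the space with
  index one half is \<open>D'\<close> with norm \<open>norm (S z)\<close>, and the space with index one is \<open>D\<close>
  with norm \<open>norm (A z)\<close>.\<close>

definition positive_sqrt ::
  "'h::real_inner set \<Rightarrow> ('h \<Rightarrow> 'h) \<Rightarrow> 'h set \<Rightarrow> ('h \<Rightarrow> 'h) \<Rightarrow> bool" where
  "positive_sqrt D A D' S \<longleftrightarrow> self_adjoint D' S \<and> positive_operator D' S \<and>
     {x \<in> D'. S x \<in> D'} = D \<and> (\<forall>x\<in>D. S (S x) = A x)"

definition norm_sq_half_0 :: "('h::real_inner \<Rightarrow> 'h) \<Rightarrow> 'h \<Rightarrow> 'h \<Rightarrow> real" where
  "norm_sq_half_0 S x y = (norm (S x))\<^sup>2 + (norm y)\<^sup>2"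

definition norm_sq_1_half ::
  "('h::real_inner \<Rightarrow> 'h) \<Rightarrow> ('h \<Rightarrow> 'h) \<Rightarrow> 'h \<Rightarrow> 'h \<Rightarrow> real" where
  "norm_sq_1_half A S x y = (norm (A x))\<^sup>2 + (norm (S y))\<^sup>2"

text \<open>\<open>u\<close> solves \<open>u'' + A u + K u' = 0\<close>, \<open>u 0 = u0\<close>, \<open>u' 0 = u1\<close> on \<open>[0,\<infinity>)\<close>, with \<open>u' = v\<close> and
  \<open>(u, v)\<close> continuous from \<open>[0,\<infinity>)\<close> into the product of the spaces with indices one and one
  half: continuity of \<open>A \<circ> u\<close> is continuity of \<open>u\<close> for the norm \<open>norm (A z)\<close>, and likewise
  for \<open>S \<circ> v\<close>. At time \<open>0\<close> the derivatives are one-sided; values at negative times are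
  irrelevant.\<close>

definition is_solution ::
  "'h::real_inner set \<Rightarrow> ('h \<Rightarrow> 'h) \<Rightarrow> 'h set \<Rightarrow> ('h \<Rightarrow> 'h) \<Rightarrow> ('h \<Rightarrow> 'h) \<Rightarrow>
   'h \<Rightarrow> 'h \<Rightarrow> (real \<Rightarrow> 'h) \<Rightarrow> (real \<Rightarrow> 'h) \<Rightarrow> bool" where
  "is_solution D A D' S K u0 u1 u v \<longleftrightarrow>
     u 0 = u0 \<and> v 0 = u1 \<and>
     (\<forall>t\<ge>0. u t \<in> D \<and> v t \<in> D') \<and>
     continuous_on {0..} (\<lambda>t. A (u t)) \<and> continuous_on {0..} (\<lambda>t. S (v t)) \<and>
     (\<forall>t\<ge>0. (u has_vector_derivative v t) (at t within {0..})) \<and>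
     (\<forall>t\<ge>0. (v has_vector_derivative - (A (u t)) - K (v t)) (at t within {0..}))"

definition well_posed ::
  "'h::real_inner set \<Rightarrow> ('h \<Rightarrow> 'h) \<Rightarrow> 'h set \<Rightarrow> ('h \<Rightarrow> 'h) \<Rightarrow> ('h \<Rightarrow> 'h) \<Rightarrow> bool" where
  "well_posed D A D' S K \<longleftrightarrow>
     (\<forall>u0\<in>D. \<forall>u1\<in>D'. \<exists>u v. is_solution D A D' S K u0 u1 u v \<and>
        (\<forall>x y. is_solution D A D' S K u0 u1 x y \<longrightarrow> (\<forall>t\<ge>0. x t = u t \<and> y t = v t)))"

end

theory Submission
  imports Defs
begin

text \<open>
  Let \<open>N\<^sub>0(t)\<close> and \<open>N\<^sub>1(t)\<close> be the squared norms of \<open>(w(t), w'(t))\<close> with indices \<open>(1/2, 0)\<close> and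
  \<open>(1, 1/2)\<close>. The energy identity is \<open>N\<^sub>0' = - 2 \<parallel>B\<^sup>* w'\<parallel>\<^sup>2\<close>. Comparing \<open>w\<close> with the undamped
  solution with the same data, the difference is driven by \<open>B B\<^sup>* w'\<close> only, so the observability
  integral over \<open>[0, T]\<close> is at most a multiple of \<open>N\<^sub>0(0) - N\<^sub>0(T)\<close>. The generator of the damped
  flow is dissipative, and its graph norm is equivalent to the norm with index \<open>(1, 1/2)\<close>; hence
  \<open>N\<^sub>1(t) \<le> M N\<^sub>1(0)\<close>. After normalisation \<open>e\<^sub>k = N\<^sub>0(k T) / (const \<cdot> N\<^sub>1(0))\<close> satisfies
  \<open>e\<^sub>k\<^sub>+\<^sub>1 \<le> e\<^sub>k - c H(e\<^sub>k)\<close>. As \<open>H(x) / x\<close> is increasing, \<open>h\<^sub>k = H(e\<^sub>k)\<close> satisfies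
  \<open>h\<^sub>k\<^sub>+\<^sub>1 \<le> h\<^sub>k - c h\<^sub>k\<^sup>2\<close>, so \<open>h\<^sub>k = O(1 / k)\<close>.
\<close>

subsection \<open>Adjoints of bounded operators on Hilbert spaces\<close>

text \<open>The representing vector minimises the quadratic functional \<open>J\<close>. A
  minimising sequence is Cauchy by the parallelogram law, and at the minimiser the first variation
  of \<open>J\<close> vanishes in every direction.\<close>

lemma riesz_representation:
  fixes f :: "'a::{real_inner, complete_space} \<Rightarrow> real"
  assumes "bounded_linear f"
  shows "\<exists>z. \<forall>x. f x = x \<bullet> z"
proof -
  interpret f: bounded_linear f by fact
  define J where "J = (\<lambda>x. (norm x)\<^sup>2 - 2 * f x)"
  obtain b where b: "\<And>x. norm (f x) \<le> norm x * b"
    using f.bounded by blast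
  have J_ge: "- (b\<^sup>2) \<le> J x" for x
  proof -
    have "f x \<le> norm x * b" using b[of x] by simp
    moreover have "0 \<le> (norm x - b)\<^sup>2" by simp
    ultimately show ?thesis by (simp add: J_def power2_diff)
  qed
  define m where "m = Inf (range J)"
  have bdd: "bdd_below (range J)" using J_ge by (auto intro!: bdd_belowI)
  have m_le: "m \<le> J x" for x unfolding m_def by (rule cInf_lower[OF _ bdd]) simp
  have "\<exists>x. J x < m + inverse (real (Suc n))" for n
  proof -
    have "Inf (range J) < m + inverse (real (Suc n))" by (simp add: m_def)
    then show ?thesis using cInf_less_iff[OF _ bdd] by auto
  qed
  then obtain X where X: "\<And>n. J (X n) < m + inverse (real (Suc n))" by metis
  \<comment> \<open>The linear parts of \<open>J\<close> cancel in the parallelogram law, and the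
    midpoint term is at least \<open>m\<close>; so two near-minimisers are close to each
    other.\<close>
  have parallelogram: "(norm (x - y))\<^sup>2 \<le> 2 * J x + 2 * J y - 4 * m" for x y
  proof -
    have "(norm (x - y))\<^sup>2 = 2 * J x + 2 * J y - 4 * J ((1/2) *\<^sub>R (x + y))"
      unfolding J_def power2_norm_eq_inner
      by (simp add: f.scaleR f.add inner_simps inner_commute algebra_simps)
    moreover have "4 * m \<le> 4 * J ((1/2) *\<^sub>R (x + y))" using m_le by simp
    ultimately show ?thesis by linarith
  qed
  have "Cauchy X"
  proof (rule metric_CauchyI)
    fix e :: real assume "0 < e"
    then have "0 < e\<^sup>2 / 4" by simp
    then obtain k where k: "inverse (real (Suc k)) < e\<^sup>2 / 4" using reals_Archimedean by blast
    have small: "J (X n) - m < e\<^sup>2 / 4" if "k \<le> n" for n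
    proof -
      have "inverse (real (Suc n)) \<le> inverse (real (Suc k))" using that by (simp add: field_simps)
      then show ?thesis using X[of n] k by linarith
    qed
    have "dist (X i) (X j) < e" if "k \<le> i" "k \<le> j" for i j
    proof -
      have "(norm (X i - X j))\<^sup>2 < e\<^sup>2"
        using parallelogram[of "X i" "X j"] small[OF that(1)] small[OF that(2)] by linarith
      then show ?thesis using \<open>0 < e\<close> by (simp add: dist_norm power2_less_imp_less)
    qed
    then show "\<exists>M. \<forall>i\<ge>M. \<forall>j\<ge>M. dist (X i) (X j) < e" by blast
  qed
  then obtain z where z: "X \<longlonglongrightarrow> z" using Cauchy_convergent_iff convergent_def by blast
  have "(\<lambda>n. J (X n)) \<longlonglongrightarrow> J z" unfolding J_def by (intro tendsto_intros f.tendsto z)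
  moreover have "(\<lambda>n. m + inverse (real (Suc n))) \<longlonglongrightarrow> m"
    using tendsto_add[OF tendsto_const LIMSEQ_inverse_real_of_nat] by simp
  ultimately have Jz: "J z \<le> m"
    by (rule LIMSEQ_le) (use X less_imp_le in blast)
  have "f x = x \<bullet> z" for x
  proof (rule ccontr)
    assume ne: "f x \<noteq> x \<bullet> z"
    define d where "d = f x - x \<bullet> z"
    have expand: "J (z + s *\<^sub>R x) = J z - 2 * s * d + s\<^sup>2 * (norm x)\<^sup>2" for s
      unfolding J_def d_def power2_norm_eq_inner
      by (simp add: f.scaleR f.add inner_simps inner_commute algebra_simps power2_eq_square)
    \<comment> \<open>The step \<open>d / n\<close> along \<open>x\<close> would lower
      \<open>J\<close> by at least \<open>d * d / n\<close>. The added 1 keeps \<open>n\<close>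
      positive without a case distinction on \<open>x = 0\<close>.\<close>
    define n where "n = (norm x)\<^sup>2 + 1"
    have "n > 0" unfolding n_def by (smt (verit) zero_le_power2)
    have "J z \<le> J (z + (d / n) *\<^sub>R x)" using Jz m_le order_trans by blast
    then have "2 * (d / n) * d \<le> (d / n)\<^sup>2 * (n - 1)" using expand[of "d / n"] by (simp add: n_def)
    also have "\<dots> \<le> (d / n)\<^sup>2 * n" by (intro mult_left_mono) auto
    also have "\<dots> = (d / n) * d" using \<open>n > 0\<close> by (simp add: power2_eq_square)
    finally have "d * d / n \<le> 0" by simp
    moreover have "d \<noteq> 0" using ne by (simp add: d_def)
    then have "d * d / n > 0" using \<open>n > 0\<close> by (metis divide_pos_pos not_real_square_gt_zero)
    ultimately show False by simp
  qed
  then show ?thesis by blast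
qed

text \<open>\<open>adjoint\<close> is a choice among functions with this property, so the property
  holds once some such function exists; Riesz representation supplies one.\<close>

lemma inner_adjoint:
  fixes B :: "'a::{real_inner, complete_space} \<Rightarrow> 'b::real_inner"
  assumes "bounded_linear B"
  shows "B x \<bullet> y = x \<bullet> adjoint B y"
proof -
  have "\<exists>z. \<forall>x. B x \<bullet> y = x \<bullet> z" for y
    by (rule riesz_representation) (rule bounded_linear_inner_left_comp[OF assms])
  then have "\<exists>g. \<forall>x y. B x \<bullet> y = x \<bullet> g y" by metis
  then have "\<forall>x y. B x \<bullet> y = x \<bullet> adjoint B y"
    unfolding adjoint_def by (rule someI_ex)
  then show ?thesis by blast
qed

text \<open>Testing the adjoint identity with \<open>adjoint B y\<close> itself gives the bound with
  the same constant as for \<open>B\<close>.\<close>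

lemma norm_adjoint_le:
  fixes B :: "'a::{real_inner, complete_space} \<Rightarrow> 'b::real_inner"
  assumes B: "bounded_linear B" and b: "0 \<le> b" "\<And>x. norm (B x) \<le> b * norm x"
  shows "norm (adjoint B y) \<le> b * norm y"
proof (cases "adjoint B y = 0")
  case True
  then show ?thesis using b(1) by simp
next
  case False
  have "norm (adjoint B y) * norm (adjoint B y) = B (adjoint B y) \<bullet> y"
    by (simp add: inner_adjoint[OF B] flip: power2_eq_square power2_norm_eq_inner)
  also have "\<dots> \<le> norm (B (adjoint B y)) * norm y" by (rule norm_cauchy_schwarz)
  also have "\<dots> \<le> b * norm (adjoint B y) * norm y" by (intro mult_right_mono b) simp
  finally have "norm (adjoint B y) * norm (adjoint B y) \<le> norm (adjoint B y) * (b * norm y)"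
    by (simp add: mult_ac)
  then show ?thesis using False by (simp add: mult_le_cancel_left)
qed

lemma bounded_linear_adjoint:
  fixes B :: "'a::{real_inner, complete_space} \<Rightarrow> 'b::real_inner"
  assumes B: "bounded_linear B"
  shows "bounded_linear (adjoint B)"
proof -
  interpret B: bounded_linear B by fact
  obtain b where b: "0 \<le> b" "\<And>x. norm (B x) \<le> norm x * b"
    using B.nonneg_bounded by blast
  have eqI: "u = v" if "\<And>x::'a. x \<bullet> u = x \<bullet> v" for u v
    using that by (metis vector_eq_ldot)
  show ?thesis
  proof (rule bounded_linear_intro)
    show "adjoint B (x + y) = adjoint B x + adjoint B y" for x y
      by (rule eqI) (simp add: inner_adjoint[OF B, symmetric] inner_add_right)
    show "adjoint B (r *\<^sub>R x) = r *\<^sub>R adjoint B x" for r x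
      by (rule eqI) (simp add: inner_adjoint[OF B, symmetric])
    show "norm (adjoint B x) \<le> norm x * b" for x
      using norm_adjoint_le[OF B b(1), of x] b(2) by (simp add: mult.commute)
  qed
qed

subsection \<open>A discrete decay estimate\<close>

text \<open>With \<open>h = H (e k)\<close>, monotonicity of \<open>H x / x\<close> gives a discrete
  form of the inequality h' \<le> - c h^2, so \<open>1 / h\<close> grows by at least
  \<open>c\<close> per step. In the maximum, \<open>H (1/2)\<close> settles the start and
  \<open>1 / c\<close> makes each increment at least \<open>1 / K\<close>. Starting at 1/2 or below
  keeps the sequence where the ratio is monotone.\<close>

lemma decreasing_recursion_bound:
  fixes H :: "real \<Rightarrow> real" and e :: "nat \<Rightarrow> real"
  assumes H_pos: "\<And>x. 0 < x \<Longrightarrow> 0 < H x"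
    and H_mono: "mono_on {0<..} H"
    and ratio: "mono_on {0<..<1} (\<lambda>x. 1 / x * H x)"
    and "0 < c"
    and e0: "e 0 \<le> 1/2"
    and e_Suc: "\<And>k. 0 < e k \<Longrightarrow> e (Suc k) \<le> e k - c * H (e k)"
    and e_decr: "\<And>k. e (Suc k) \<le> e k"
    and "0 < e k"
  shows "H (e k) \<le> max (H (1/2)) (1 / c) / (1 + real k)"
  using \<open>0 < e k\<close>
proof (induction k)
  case 0
  then have "H (e 0) \<le> H (1/2)" using e0 by (intro mono_onD[OF H_mono]) auto
  then show ?case by simp
next
  case (Suc k)
  define K where "K = max (H (1/2)) (1 / c)"
  have "K > 0" using H_pos[of "1/2"] by (simp add: K_def)
  have "1 / c \<le> K" by (simp add: K_def)
  then have cK: "1 / K \<le> c" using \<open>K > 0\<close> \<open>0 < c\<close> by (simp add: field_simps)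
  have pos: "0 < e k" using Suc.prems e_decr[of k] by linarith
  have "e j \<le> 1/2" for j by (induction j) (use e0 e_decr order_trans in blast)+
  then have "e k \<le> 1/2" .
  define h h' where "h = H (e k)" and "h' = H (e (Suc k))"
  have hpos: "h > 0" "h' > 0" using pos Suc.prems H_pos by (auto simp: h_def h'_def)
  have "1 / e (Suc k) * h' \<le> 1 / e k * h"
    unfolding h_def h'_def
    using mono_onD[OF ratio, of "e (Suc k)" "e k"] Suc.prems pos e_decr[of k] \<open>e k \<le> 1/2\<close> by auto
  then have "h' * e k \<le> h * e (Suc k)" using Suc.prems pos by (simp add: field_simps)
  also have "\<dots> \<le> h * (e k - c * h)" using hpos e_Suc[OF pos] by (intro mult_left_mono) (auto simp: h_def)
  also have "\<dots> = h * e k - c * h\<^sup>2" by (simp add: algebra_simps power2_eq_square)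
  \<comment> \<open>Since \<open>e k\<close> is at most 1, it can be inserted in the negative term;
    the common factor \<open>e k\<close> then cancels.\<close>
  also have "\<dots> \<le> h * e k - c * h\<^sup>2 * e k"
    using \<open>e k \<le> 1/2\<close> pos \<open>0 < c\<close> hpos by (simp add: mult_left_le)
  also have "\<dots> = (h * (1 - c * h)) * e k" by (simp add: algebra_simps power2_eq_square)
  finally have "h' \<le> h * (1 - c * h)" using pos by simp
  then have "1 - c * h > 0" using hpos by (smt (verit) zero_less_mult_pos)
  \<comment> \<open>Because (1 - c h)(1 + c h) is at most 1, this product bound passes to
    reciprocals as an additive gain of \<open>c\<close>.\<close>
  have "h' * (1 + c * h) \<le> h * (1 - c * h) * (1 + c * h)"
    using \<open>h' \<le> _\<close> hpos \<open>0 < c\<close> by (intro mult_right_mono) auto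
  also have "\<dots> = h - h * (c * h)\<^sup>2" by (simp add: algebra_simps power2_eq_square)
  also have "\<dots> \<le> h" using hpos by simp
  finally have "1 / h + c \<le> 1 / h'" using hpos by (simp add: field_simps)
  moreover have "(1 + real k) / K \<le> 1 / h"
    using Suc.IH[OF pos] hpos \<open>K > 0\<close> by (simp add: K_def[symmetric] h_def[symmetric] field_simps)
  ultimately have "(1 + real k) / K + 1 / K \<le> 1 / h'" using cK by linarith
  then have "(1 + real (Suc k)) / K \<le> 1 / h'" by (simp add: add_divide_distrib)
  then show ?case
    using hpos \<open>K > 0\<close> by (simp add: K_def[symmetric] h'_def[symmetric] field_simps)
qed

text \<open>This inverts \<open>H\<close> up to constants: a factor \<open>K\<close> between values
  of \<open>H\<close> costs only the same factor between arguments. For x < e, H(x) / x \<le> H(e) /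
  e \<le> K H(x) / e, and \<open>H x\<close> cancels.\<close>

lemma le_mult_of_ratio_mono:
  fixes H :: "real \<Rightarrow> real"
  assumes H_pos: "\<And>x. 0 < x \<Longrightarrow> 0 < H x"
    and ratio: "mono_on {0<..<1} (\<lambda>x. 1 / x * H x)"
    and "0 < e" "e < 1" "0 < x" "1 \<le> K" "H e \<le> K * H x"
  shows "e \<le> K * x"
proof (cases "e \<le> x")
  case True
  then show ?thesis using assms by (smt (verit) mult_le_cancel_right1)
next
  case False
  then have "1 / x * H x \<le> 1 / e * H e" using mono_onD[OF ratio, of x e] assms by auto
  then have "e * H x \<le> x * H e" using assms by (simp add: field_simps)
  also have "\<dots> \<le> x * (K * H x)" using assms by (intro mult_left_mono) auto
  finally have "e * H x \<le> (K * x) * H x" by (simp add: mult_ac)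
  then show ?thesis using H_pos[OF \<open>0 < x\<close>] by simp
qed

text \<open>The ratio is monotone only on (0,1), while the argument of \<open>H\<close> in the
  observability estimate may exceed 1. There the comparison goes through 1/2: H(y) / y \<le> 2
  H(1/2) \<le> 2 H(x) = 2 x (H(x) / x), with x \<le> r.\<close>

lemma ratio_le_beyond_unit_interval:
  fixes H :: "real \<Rightarrow> real"
  assumes H_pos: "\<And>x. 0 < x \<Longrightarrow> 0 < H x"
    and H_mono: "mono_on {0<..} H"
    and ratio: "mono_on {0<..<1} (\<lambda>x. 1 / x * H x)"
    and xy: "0 < y" "y \<le> x" "y \<le> 1/2" "x \<le> r"
  shows "H y / y \<le> (1 + 2 * r) * (H x / x)"
proof (cases "x < 1")
  case True
  then have "1 / y * H y \<le> 1 / x * H x" using mono_onD[OF ratio, of y x] xy by auto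
  moreover have "0 \<le> 2 * r * (H x / x)" using xy H_pos[of x] by simp
  ultimately show ?thesis by (simp add: algebra_simps)
next
  case False
  have "1 / y * H y \<le> 1 / (1/2) * H (1/2)" using mono_onD[OF ratio, of y "1/2"] xy by auto
  moreover have "H (1/2) \<le> H x" using mono_onD[OF H_mono, of "1/2" x] False by auto
  ultimately have "H y / y \<le> 2 * x * (H x / x)" using False by simp
  also have "\<dots> \<le> (1 + 2 * r) * (H x / x)"
    using xy H_pos[of x] by (intro mult_right_mono) auto
  finally show ?thesis .
qed

subsection \<open>Energy estimates\<close>

text \<open>At interior points the derivative within \<open>{0..}\<close> is a two-sided derivative;
  at the endpoints continuity suffices.\<close>

lemma nonincreasing_half_line:
  fixes f f' :: "real \<Rightarrow> real"
  assumes der: "\<And>t. 0 \<le> t \<Longrightarrow> (f has_real_derivative f' t) (at t within {0..})"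
    and le: "\<And>t. 0 \<le> t \<Longrightarrow> f' t \<le> 0"
    and st: "0 \<le> s" "s \<le> t"
  shows "f t \<le> f s"
proof (rule DERIV_nonpos_imp_decreasing_open[OF st(2)])
    show "continuous_on {s..t} f"
      by (rule continuous_on_subset[of "{0..}"])
        (use der st in \<open>auto simp: continuous_on_eq_continuous_within intro: DERIV_continuous\<close>)
    show "\<exists>y. (f has_real_derivative y) (at x) \<and> y \<le> 0" if "s < x" "x < t" for x
    proof -
      have "at x within {0..} = at x" using that st by (intro at_within_interior) simp
      then show ?thesis using der[of x] le[of x] that st by auto
    qed
qed

lemma has_real_derivative_norm_sq:
  fixes f :: "real \<Rightarrow> 'a::real_inner"
  assumes "(f has_vector_derivative f') (at t within s)"
  shows "((\<lambda>t. (norm (f t))\<^sup>2) has_real_derivative 2 * (f t \<bullet> f')) (at t within s)"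
proof -
  have "((\<lambda>t. f t \<bullet> f t) has_derivative (\<lambda>h. f t \<bullet> (h *\<^sub>R f') + (h *\<^sub>R f') \<bullet> f t)) (at t within s)"
    using assms unfolding has_vector_derivative_def
    by (intro has_derivative_inner)
  then show ?thesis
    unfolding has_field_derivative_def power2_norm_eq_inner
    by (rule has_derivative_eq_rhs) (auto simp: inner_commute)
qed

lemma linear_operator_diff:
  assumes "linear_operator E F" "x \<in> E" "y \<in> E"
  shows "F (x - y) = F x - F y"
proof -
  have "- y \<in> E" using assms by (auto simp: linear_operator_def subspace_neg)
  moreover have "F (- y) = - F y"
    using assms unfolding linear_operator_def by (metis scaleR_minus1_left)
  ultimately have "F (x + - y) = F x + - F y"
    using assms unfolding linear_operator_def by metis
  then show ?thesis by simp
qed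

lemma norm_sq_add_le:
  fixes x y :: "'a::real_inner"
  shows "(norm (x + y))\<^sup>2 \<le> 2 * (norm x)\<^sup>2 + 2 * (norm y)\<^sup>2"
proof -
  have "0 \<le> (norm (x - y))\<^sup>2" by simp
  then show ?thesis unfolding power2_norm_eq_inner by (simp add: inner_simps inner_commute)
qed

section \<open>The damped system and the square root operator\<close>

locale damped_system =
  fixes D D' :: "'h::{real_inner, complete_space} set"
    and A S :: "'h \<Rightarrow> 'h"
    and B :: "'u::{real_inner, complete_space} \<Rightarrow> 'h"
  assumes inv_A: "boundedly_invertible D A"
    and lin_A: "linear_operator D A"
    and sqrt: "positive_sqrt D A D' S"
    and bl_B: "bounded_linear B"
begin

abbreviation "Bs \<equiv> adjoint B"
abbreviation "N0 \<equiv> norm_sq_half_0 S"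
abbreviation "N1 \<equiv> norm_sq_1_half A S"

lemma linear_operator_S: "linear_operator D' S"
  using sqrt by (simp add: positive_sqrt_def self_adjoint_def)

lemma subspace_D: "subspace D" and subspace_D': "subspace D'"
  using lin_A linear_operator_S by (auto simp: linear_operator_def)

lemmas A_diff = linear_operator_diff[OF lin_A]
lemmas S_diff = linear_operator_diff[OF linear_operator_S]

lemma S_zero: "S 0 = 0"
  using S_diff[of 0 0] subspace_0[OF subspace_D'] by simp

lemma S_sym: "x \<in> D' \<Longrightarrow> y \<in> D' \<Longrightarrow> S x \<bullet> y = x \<bullet> S y"
  using sqrt by (simp add: positive_sqrt_def self_adjoint_def)

lemma D_iff: "x \<in> D \<longleftrightarrow> x \<in> D' \<and> S x \<in> D'"
  using sqrt by (auto simp: positive_sqrt_def)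

lemma S_S: "x \<in> D \<Longrightarrow> S (S x) = A x"
  using sqrt by (simp add: positive_sqrt_def)

text \<open>With \<open>R\<close> the inverse of \<open>A\<close>, the inverse of \<open>S\<close>
  is \<open>S\<close> after \<open>R\<close>, and it is bounded because |S R y|^2 = (R y, y). The
  last property is the continuous embedding into H of the space with index 1/2.\<close>

lemma bounded_inverse_S:
  obtains Q c where "bounded_linear Q" "0 < c"
    "\<And>y. Q y \<in> D'" "\<And>y. S (Q y) = y" "\<And>x. x \<in> D' \<Longrightarrow> Q (S x) = x"
    "\<And>x. x \<in> D' \<Longrightarrow> (norm x)\<^sup>2 \<le> c * (norm (S x))\<^sup>2"
proof -
  obtain R where R: "bounded_linear R" "\<And>y. R y \<in> D" "\<And>y. A (R y) = y" "\<And>x. x \<in> D \<Longrightarrow> R (A x) = x"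
    using inv_A unfolding boundedly_invertible_def by blast
  interpret R: bounded_linear R by (rule R)
  obtain c where c: "0 < c" "\<And>y. norm (R y) \<le> norm y * c" using R.pos_bounded by blast
  define Q where "Q = (\<lambda>y. S (R y))"
  have RD': "R y \<in> D'" and QD': "Q y \<in> D'" for y using R(2)[of y] by (auto simp: D_iff Q_def)
  have SQ: "S (Q y) = y" for y using S_S[OF R(2), of y] R(3) by (simp add: Q_def)
  \<comment> \<open>A difference with \<open>S (x - y) = 0\<close> lies in \<open>D\<close>, since 0
    is in \<open>D'\<close>; there \<open>A\<close> is \<open>S\<close> applied twice, so
    \<open>A\<close> kills it and injectivity of \<open>A\<close> applies.\<close>
  have S_inj: "x = y" if "x \<in> D'" "y \<in> D'" "S x = S y" for x y
  proof -
    have d: "S (x - y) = 0" "x - y \<in> D'"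
      using that by (auto simp: S_diff subspace_diff[OF subspace_D'])
    then have "x - y \<in> D" by (simp add: D_iff subspace_0[OF subspace_D'])
    then have "x - y = R 0" using R(4)[of "x - y"] S_S[of "x - y"] d S_zero by simp
    then show ?thesis by (simp add: R.zero)
  qed
  have QS: "Q (S x) = x" if "x \<in> D'" for x by (rule S_inj) (use that QD' SQ in auto)
  have norm_Q: "(norm (Q y))\<^sup>2 \<le> c * (norm y)\<^sup>2" for y
  proof -
    have "(norm (Q y))\<^sup>2 = S (R y) \<bullet> Q y" by (simp add: power2_norm_eq_inner Q_def)
    also have "\<dots> = R y \<bullet> y" using S_sym[OF RD' QD'] SQ by simp
    also have "\<dots> \<le> norm (R y) * norm y" by (rule norm_cauchy_schwarz)
    also have "\<dots> \<le> (norm y * c) * norm y" by (intro mult_right_mono c) simp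
    finally show ?thesis by (simp add: power2_eq_square mult_ac)
  qed
  have "bounded_linear Q"
  proof (rule bounded_linear_intro)
    show "Q (x + y) = Q x + Q y" for x y
      using linear_operator_S RD' by (simp add: Q_def R.add linear_operator_def)
    show "Q (r *\<^sub>R x) = r *\<^sub>R Q x" for r x
      using linear_operator_S RD' by (simp add: Q_def R.scaleR linear_operator_def)
    show "norm (Q x) \<le> norm x * sqrt c" for x
      using real_sqrt_le_mono[OF norm_Q[of x]] by (simp add: real_sqrt_mult mult.commute)
  qed
  moreover have "(norm x)\<^sup>2 \<le> c * (norm (S x))\<^sup>2" if "x \<in> D'" for x
    using norm_Q[of "S x"] QS[OF that] by simp
  ultimately show ?thesis using that c(1) QD' SQ QS by blast
qed

text \<open>The inequality is closed in \<open>y\<close> and \<open>D'\<close> is dense, so it may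
  be tested at \<open>y = z\<close>.\<close>

lemma norm_le_of_inner_le:
  assumes "0 \<le> C" "\<And>y. y \<in> D' \<Longrightarrow> z \<bullet> y \<le> C * norm y"
  shows "norm z \<le> C"
proof -
  have "closure D' \<subseteq> {y. z \<bullet> y \<le> C * norm y}"
    using assms by (intro closure_minimal closed_Collect_le continuous_intros) auto
  moreover have "closure D' = UNIV"
    using sqrt by (simp add: positive_sqrt_def self_adjoint_def)
  ultimately have "z \<bullet> z \<le> C * norm z" by auto
  then have *: "norm z * norm z \<le> C * norm z"
    by (simp flip: power2_eq_square power2_norm_eq_inner)
  show ?thesis using * \<open>0 \<le> C\<close> by (cases "z = 0") auto
qed

text \<open>
  \<open>S\<close> is unbounded, so the difference quotients of \<open>S \<circ> u\<close> are tested against the dense set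
  \<open>D'\<close>, where \<open>S\<close> moves to the other side of the inner product.
\<close>

lemma has_vector_derivative_S:
  assumes u: "\<And>t. 0 \<le> t \<Longrightarrow> u t \<in> D'" and v: "\<And>t. 0 \<le> t \<Longrightarrow> v t \<in> D'"
    and cont: "continuous_on {0..} (\<lambda>t. S (v t))"
    and der: "\<And>t. 0 \<le> t \<Longrightarrow> (u has_vector_derivative v t) (at t within {0..})"
    and t: "0 \<le> (t::real)"
  shows "((\<lambda>t. S (u t)) has_vector_derivative S (v t)) (at t within {0..})"
  unfolding has_vector_derivative_def has_derivative_within_alt
proof (intro conjI allI impI)
  show "bounded_linear (\<lambda>x. x *\<^sub>R S (v t))" by (rule bounded_linear_scaleR_left)
  fix e :: real assume "0 < e"
  then obtain d where "0 < d" and d: "\<And>s. 0 \<le> s \<Longrightarrow> dist s t < d \<Longrightarrow> dist (S (v s)) (S (v t)) < e"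
    using cont t unfolding continuous_on_iff by (metis atLeast_iff)
  have "norm (S (u r) - S (u t) - (r - t) *\<^sub>R S (v t)) \<le> e * norm (r - t)"
    if r: "0 \<le> r" "norm (r - t) < d" for r
  proof (rule norm_le_of_inner_le)
    show "0 \<le> e * norm (r - t)" using \<open>0 < e\<close> by simp
    fix y assume y: "y \<in> D'"
    \<comment> \<open>The increment of \<open>f\<close> is the inner product to be bounded. Its
      derivative is \<open>(S (v s) - S (v t)) \<bullet> y\<close>, small near \<open>t\<close> by
      continuity, so the mean value inequality applies.\<close>
    define f where "f = (\<lambda>s. u s \<bullet> S y - s * (S (v t) \<bullet> y))"
    have "norm (f r - f t) \<le> e * norm y * norm (r - t)"
    proof (rule field_differentiable_bound)
      show "convex ({0..} \<inter> ball t d)" by (intro convex_Int convex_ball) simp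
      show "r \<in> {0..} \<inter> ball t d" "t \<in> {0..} \<inter> ball t d"
        using r t \<open>0 < d\<close> by (auto simp: dist_norm norm_minus_commute)
      fix s assume s: "s \<in> {0..} \<inter> ball t d"
      have "((\<lambda>s. u s \<bullet> S y) has_vector_derivative v s \<bullet> S y) (at s within {0..})"
        using s by (intro bounded_linear.has_vector_derivative[OF bounded_linear_inner_left der]) simp
      then have "(f has_real_derivative v s \<bullet> S y - S (v t) \<bullet> y) (at s within {0..})"
        unfolding f_def has_real_derivative_iff_has_vector_derivative[symmetric]
        by (auto intro!: derivative_eq_intros)
      then show "(f has_real_derivative v s \<bullet> S y - S (v t) \<bullet> y) (at s within {0..} \<inter> ball t d)"
        by (rule DERIV_subset) simp
      have "v s \<bullet> S y - S (v t) \<bullet> y = (S (v s) - S (v t)) \<bullet> y"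
        using S_sym[OF v y] s by (simp add: inner_diff_left)
      also have "norm \<dots> \<le> norm (S (v s) - S (v t)) * norm y"
        using Cauchy_Schwarz_ineq2 by simp
      also have "\<dots> \<le> e * norm y"
        using d[of s] s by (intro mult_right_mono) (auto simp: dist_norm abs_minus_commute)
      finally show "norm (v s \<bullet> S y - S (v t) \<bullet> y) \<le> e * norm y" .
    qed
    moreover have "(S (u r) - S (u t) - (r - t) *\<^sub>R S (v t)) \<bullet> y = f r - f t"
      using S_sym[OF u[OF r(1)] y] S_sym[OF u[OF t] y]
      by (simp add: f_def inner_diff_left algebra_simps)
    ultimately show "(S (u r) - S (u t) - (r - t) *\<^sub>R S (v t)) \<bullet> y \<le> e * norm (r - t) * norm y"
      by (simp add: mult_ac)
  qed
  then show "\<exists>d>0. \<forall>r\<in>{0..}. norm (r - t) < d \<longrightarrow>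
      norm (S (u r) - S (u t) - (r - t) *\<^sub>R S (v t)) \<le> e * norm (r - t)"
    using \<open>0 < d\<close> by auto
qed

text \<open>The terms (S u, S v) and (v, A u) cancel by symmetry of \<open>S\<close>. The forcing
  \<open>f\<close> is left free so that the identity covers both a damped solution and the
  difference between a damped and an undamped one.\<close>

lemma energy_derivative:
  assumes "u t \<in> D" "v t \<in> D'"
    and "((\<lambda>t. S (u t)) has_vector_derivative S (v t)) (at t within {0..})"
    and "(v has_vector_derivative - A (u t) + f) (at t within {0..})"
  shows "((\<lambda>t. N0 (u t) (v t)) has_real_derivative 2 * (v t \<bullet> f)) (at t within {0..})"
proof -
  have "S (u t) \<bullet> S (v t) = A (u t) \<bullet> v t"
    using S_sym[of "S (u t)" "v t"] assms(1,2) by (simp add: D_iff S_S)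
  then have "2 * (S (u t) \<bullet> S (v t)) + 2 * (v t \<bullet> (- A (u t) + f)) = 2 * (v t \<bullet> f)"
    by (simp add: inner_commute inner_simps)
  then show ?thesis
    unfolding norm_sq_half_0_def
    using DERIV_add[OF has_real_derivative_norm_sq[OF assms(3)] has_real_derivative_norm_sq[OF assms(4)]]
    by simp
qed

section \<open>Damped and undamped solutions: energy, time shifts, differences\<close>

abbreviation "damped \<equiv> is_solution D A D' S (\<lambda>x. B (Bs x))"
abbreviation "undamped \<equiv> is_solution D A D' S (\<lambda>x. 0)"

lemma solutionD:
  assumes "is_solution D A D' S K u0 u1 u v"
  shows "u 0 = u0" "v 0 = u1"
    "continuous_on {0..} (\<lambda>t. A (u t))" "continuous_on {0..} (\<lambda>t. S (v t))"
    and "\<And>t. 0 \<le> t \<Longrightarrow> u t \<in> D" "\<And>t. 0 \<le> t \<Longrightarrow> v t \<in> D'"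
    "\<And>t. 0 \<le> t \<Longrightarrow> (u has_vector_derivative v t) (at t within {0..})"
    "\<And>t. 0 \<le> t \<Longrightarrow> (v has_vector_derivative - (A (u t)) - K (v t)) (at t within {0..})"
  using assms by (auto simp: is_solution_def)

lemma solution_S_derivative:
  assumes "is_solution D A D' S K u0 u1 u v" "0 \<le> t"
  shows "((\<lambda>t. S (u t)) has_vector_derivative S (v t)) (at t within {0..})"
  using solutionD[OF assms(1)] D_iff assms(2) by (intro has_vector_derivative_S) auto

lemma damped_energy_derivative:
  assumes "damped u0 u1 u v" "0 \<le> t"
  shows "((\<lambda>t. N0 (u t) (v t)) has_real_derivative - 2 * (norm (Bs (v t)))\<^sup>2) (at t within {0..})"
proof -
  note sol = solutionD[OF assms(1)]
  have "((\<lambda>t. N0 (u t) (v t)) has_real_derivative 2 * (v t \<bullet> - B (Bs (v t)))) (at t within {0..})"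
    by (rule energy_derivative) (use sol assms solution_S_derivative[OF assms] in auto)
  then show ?thesis
    by (simp add: inner_commute[of "v t"] inner_adjoint[OF bl_B] power2_norm_eq_inner)
qed

lemma damped_energy_nonincreasing:
  assumes "damped u0 u1 u v" "0 \<le> s" "s \<le> t"
  shows "N0 (u t) (v t) \<le> N0 (u s) (v s)"
  by (rule nonincreasing_half_line[OF damped_energy_derivative[OF assms(1)]]) (use assms in auto)

text \<open>The equation is autonomous. Shifts are used for time increments of a solution and for
  restarting the observation at multiples of T.\<close>

lemma shift_solution:
  assumes "is_solution D A D' S K u0 u1 u v" "0 \<le> h"
  shows "is_solution D A D' S K (u h) (v h) (\<lambda>t. u (t + h)) (\<lambda>t. v (t + h))"
proof -
  note sol = solutionD[OF assms(1)]
  have shift: "((\<lambda>t. f (t + h)) has_vector_derivative f') (at t within {0..})"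
    if "(f has_vector_derivative f') (at (t + h) within {0..})" for f :: "real \<Rightarrow> 'h" and f' t
  proof -
    have "((f \<circ> (\<lambda>t. t + h)) has_vector_derivative 1 *\<^sub>R f') (at t within {0..})"
      by (rule vector_diff_chain_within)
        (auto intro!: derivative_eq_intros has_vector_derivative_within_subset[OF that] simp: assms(2))
    then show ?thesis by (simp add: o_def)
  qed
  have cont: "continuous_on {0..} (\<lambda>t. f (t + h))" if "continuous_on {0..} f" for f :: "real \<Rightarrow> 'h"
    by (rule continuous_on_compose2[OF that]) (use assms(2) in \<open>auto intro!: continuous_intros\<close>)
  show ?thesis
    unfolding is_solution_def
    using sol assms(2) cont[OF sol(3)] cont[OF sol(4)] by (auto intro!: shift)
qed

lemma diff_solution:
  assumes "damped u0 u1 u v" "damped x0 x1 x y"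
  shows "damped (u0 - x0) (u1 - x1) (\<lambda>t. u t - x t) (\<lambda>t. v t - y t)"
proof -
  note s1 = solutionD[OF assms(1)] and s2 = solutionD[OF assms(2)]
  interpret B: bounded_linear B by (rule bl_B)
  interpret Bs: bounded_linear Bs by (rule bounded_linear_adjoint[OF bl_B])
  have "continuous_on {0..} (\<lambda>t. A (u t) - A (x t))"
    using s1 s2 by (intro continuous_intros)
  then have 1: "continuous_on {0..} (\<lambda>t. A (u t - x t))"
    by (rule continuous_on_eq) (use s1(5) s2(5) in \<open>simp add: A_diff\<close>)
  have "continuous_on {0..} (\<lambda>t. S (v t) - S (y t))"
    using s1 s2 by (intro continuous_intros)
  then have 2: "continuous_on {0..} (\<lambda>t. S (v t - y t))"
    by (rule continuous_on_eq) (use s1(6) s2(6) in \<open>simp add: S_diff\<close>)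
  have 3: "((\<lambda>t. v t - y t) has_vector_derivative - A (u t - x t) - B (Bs (v t - y t))) (at t within {0..})"
    if "0 \<le> t" for t
    using has_vector_derivative_diff[OF s1(8)[OF that] s2(8)[OF that]] s1(5) s2(5) that
    by (simp add: A_diff B.diff Bs.diff algebra_simps)
  show ?thesis
    unfolding is_solution_def
    using s1 s2 1 2 3
    by (auto simp: subspace_diff[OF subspace_D] subspace_diff[OF subspace_D']
        intro!: has_vector_derivative_diff)
qed

section \<open>Uniform bound in the stronger norm\<close>

abbreviation "graph_norm_sq u v \<equiv> (norm (S v))\<^sup>2 + (norm (- A u - B (Bs v)))\<^sup>2"

text \<open>\<open>graph_norm_sq\<close> is the energy of the generator applied to
  \<open>(u, v)\<close>, that is, of the time derivative of the solution. Energies of difference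
  quotients converge to it because \<open>S (u t)\<close> and \<open>v t\<close> are differentiable
  from the right at 0.\<close>

lemma difference_quotient_energy_limit:
  assumes "damped u0 u1 u v"
  shows "((\<lambda>h. N0 (u h - u 0) (v h - v 0) / h\<^sup>2) \<longlongrightarrow> graph_norm_sq u0 u1) (at_right 0)"
proof -
  note sol = solutionD[OF assms]
  have quot: "((\<lambda>h. norm (f h - f 0) / \<bar>h\<bar>) \<longlongrightarrow> norm f') (at_right 0)"
    if "(f has_vector_derivative f') (at 0 within {0..})" for f :: "real \<Rightarrow> 'h" and f'
  proof -
    have "((\<lambda>h. (f h - f 0 - h *\<^sub>R f') /\<^sub>R norm h) \<longlongrightarrow> 0) (at_right 0)"
      using that by (simp add: has_vector_derivative_def has_derivative_at_within at_within_Ici_at_right)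
    from tendsto_add[OF this tendsto_const[of f']]
    have "((\<lambda>h. (f h - f 0 - h *\<^sub>R f') /\<^sub>R norm h + f') \<longlongrightarrow> f') (at_right 0)" by simp
    moreover have "eventually (\<lambda>h. (f h - f 0 - h *\<^sub>R f') /\<^sub>R norm h + f' = (f h - f 0) /\<^sub>R \<bar>h\<bar>) (at_right 0)"
      by (rule eventually_at_right_less[THEN eventually_mono]) (simp add: scaleR_diff_right)
    ultimately have "((\<lambda>h. (f h - f 0) /\<^sub>R \<bar>h\<bar>) \<longlongrightarrow> f') (at_right 0)"
      by (rule Lim_transform_eventually)
    from tendsto_norm[OF this] show ?thesis by (simp add: divide_inverse mult.commute)
  qed
  have "((\<lambda>h. (norm (S (u h) - S (u 0)) / \<bar>h\<bar>)\<^sup>2 + (norm (v h - v 0) / \<bar>h\<bar>)\<^sup>2)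
          \<longlongrightarrow> graph_norm_sq u0 u1) (at_right 0)"
    using quot[OF solution_S_derivative[OF assms order_refl]] quot[OF sol(8)[OF order_refl]] sol(1,2)
    by (intro tendsto_intros) auto
  moreover have "eventually (\<lambda>h. (norm (S (u h) - S (u 0)) / \<bar>h\<bar>)\<^sup>2 + (norm (v h - v 0) / \<bar>h\<bar>)\<^sup>2
      = N0 (u h - u 0) (v h - v 0) / h\<^sup>2) (at_right 0)"
  proof (rule eventually_at_right_less[THEN eventually_mono])
    fix h :: real assume "0 < h"
    then show "(norm (S (u h) - S (u 0)) / \<bar>h\<bar>)\<^sup>2 + (norm (v h - v 0) / \<bar>h\<bar>)\<^sup>2
      = N0 (u h - u 0) (v h - v 0) / h\<^sup>2"
      using sol(5)[of h] sol(5)[of 0] D_iff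
      by (simp add: norm_sq_half_0_def S_diff power_divide add_divide_distrib)
  qed
  ultimately show ?thesis by (rule Lim_transform_eventually)
qed

text \<open>For fixed \<open>h\<close>, the increment over time \<open>h\<close> is a shifted
  solution minus the solution, hence itself damped, and its energy does not increase from time 0 to
  \<open>t\<close>. Dividing by \<open>h\<^sup>2\<close> and letting \<open>h\<close> tend to 0
  avoids differentiating the equation in time.\<close>

lemma damped_graph_norm_nonincreasing:
  assumes w: "damped u0 u1 u v" and "0 \<le> t"
  shows "graph_norm_sq (u t) (v t) \<le> graph_norm_sq u0 u1"
proof (rule tendsto_le)
  note shift = shift_solution[OF w]
  show "((\<lambda>h. N0 (u h - u 0) (v h - v 0) / h\<^sup>2) \<longlongrightarrow> graph_norm_sq u0 u1) (at_right 0)"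
    by (rule difference_quotient_energy_limit[OF w])
  show "((\<lambda>h. N0 (u (h + t) - u t) (v (h + t) - v t) / h\<^sup>2) \<longlongrightarrow> graph_norm_sq (u t) (v t)) (at_right 0)"
    using difference_quotient_energy_limit[OF shift[OF \<open>0 \<le> t\<close>]] by simp
  show "eventually (\<lambda>h. N0 (u (h + t) - u t) (v (h + t) - v t) / h\<^sup>2
      \<le> N0 (u h - u 0) (v h - v 0) / h\<^sup>2) (at_right 0)"
  proof (rule eventually_at_right_less[THEN eventually_mono])
    fix h :: real assume "0 < h"
    then have "0 \<le> h" by simp
    from damped_energy_nonincreasing[OF diff_solution[OF shift[OF \<open>0 \<le> h\<close>] w] order_refl \<open>0 \<le> t\<close>]
    show "N0 (u (h + t) - u t) (v (h + t) - v t) / h\<^sup>2 \<le> N0 (u h - u 0) (v h - v 0) / h\<^sup>2"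
      by (simp add: divide_right_mono add.commute)
  qed
qed simp

lemma B_bounds:
  obtains b where "0 \<le> b" "\<And>x. norm (B x) \<le> b * norm x" "\<And>y. norm (Bs y) \<le> b * norm y"
proof -
  obtain b where b: "0 \<le> b" "\<And>x. norm (B x) \<le> norm x * b"
    using bounded_linear.nonneg_bounded[OF bl_B] by blast
  then have b': "\<And>x. norm (B x) \<le> b * norm x" by (simp add: mult.commute)
  show ?thesis using that[OF b(1) b' norm_adjoint_le[OF bl_B b(1) b']] by blast
qed

text \<open>\<open>N1\<close> and \<open>graph_norm_sq\<close> differ only by the term
  \<open>B (Bs v)\<close>, which \<open>norm (S v)\<close> controls. So they are equivalent with
  constant \<open>L\<close> in both directions, and monotonicity of the graph norm costs the factor
  \<open>L * L\<close>.\<close>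

lemma N1_bounded:
  obtains M where "0 < M"
    "\<And>u0 u1 u v t. damped u0 u1 u v \<Longrightarrow> 0 \<le> t \<Longrightarrow> N1 (u t) (v t) \<le> M * N1 u0 u1"
proof -
  obtain c where c: "0 < c" "\<And>x. x \<in> D' \<Longrightarrow> (norm x)\<^sup>2 \<le> c * (norm (S x))\<^sup>2"
    using bounded_inverse_S by metis
  obtain b where b: "0 \<le> b" "\<And>x. norm (B x) \<le> b * norm x" "\<And>y. norm (Bs y) \<le> b * norm y"
    using B_bounds by metis
  define q where "q = b^4 * c"
  have "0 \<le> q" using c(1) by (simp add: q_def)
  define L where "L = 2 + 2 * q"
  have "0 < L" using \<open>0 \<le> q\<close> by (simp add: L_def)
  have K: "(norm (B (Bs y)))\<^sup>2 \<le> q * (norm (S y))\<^sup>2" if "y \<in> D'" for y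
  proof -
    have "norm (B (Bs y)) \<le> b * norm (Bs y)" by (rule b)
    also have "\<dots> \<le> b * (b * norm y)" by (intro mult_left_mono b)
    finally have "(norm (B (Bs y)))\<^sup>2 \<le> (b * (b * norm y))\<^sup>2" by (intro power_mono) auto
    also have "\<dots> = b^4 * (norm y)\<^sup>2" by (simp add: power2_eq_square power4_eq_xxxx)
    also have "\<dots> \<le> b^4 * (c * (norm (S y))\<^sup>2)" by (intro mult_left_mono c(2) that) simp
    finally show ?thesis by (simp add: q_def mult_ac)
  qed
  \<comment> \<open>Both directions of the equivalence are instances: \<open>m\<close> stands for
    the damping term, \<open>s\<close> for the squared norm of \<open>S y\<close>, and
    \<open>p\<close>, \<open>r\<close> for the two squared norms being compared.\<close>
  have L_mult: "p \<le> 2 * r + 2 * m \<Longrightarrow> m \<le> q * s \<Longrightarrow> 0 \<le> r \<Longrightarrow> 0 \<le> s \<Longrightarrow> p + s \<le> L * (r + s)"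
    for p r m s :: real
  proof -
    assume "p \<le> 2 * r + 2 * m" "m \<le> q * s" "0 \<le> r" "0 \<le> s"
    moreover have "L * (r + s) = 2 * r + 2 * s + 2 * (q * r) + 2 * (q * s)"
      by (simp add: L_def algebra_simps)
    moreover have "0 \<le> q * r" using \<open>0 \<le> q\<close> \<open>0 \<le> r\<close> by simp
    ultimately show ?thesis by linarith
  qed
  have upper: "graph_norm_sq x y \<le> L * N1 x y" if "y \<in> D'" for x y
    using norm_sq_add_le[of "- A x" "- B (Bs y)"] K[OF that]
      L_mult[of "(norm (- A x - B (Bs y)))\<^sup>2" "(norm (A x))\<^sup>2" "(norm (B (Bs y)))\<^sup>2" "(norm (S y))\<^sup>2"]
    by (simp add: norm_sq_1_half_def add.commute)
  have lower: "N1 x y \<le> L * graph_norm_sq x y" if "y \<in> D'" for x y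
    using norm_sq_add_le[of "- A x - B (Bs y)" "B (Bs y)"] K[OF that]
      L_mult[of "(norm (A x))\<^sup>2" "(norm (- A x - B (Bs y)))\<^sup>2" "(norm (B (Bs y)))\<^sup>2" "(norm (S y))\<^sup>2"]
    by (simp add: norm_sq_1_half_def add.commute)
  have "N1 (u t) (v t) \<le> L * L * N1 u0 u1" if w: "damped u0 u1 u v" and "0 \<le> t" for u0 u1 u v t
  proof -
    note sol = solutionD[OF w]
    have "N1 (u t) (v t) \<le> L * graph_norm_sq (u t) (v t)" using sol(6) \<open>0 \<le> t\<close> by (intro lower)
    also have "\<dots> \<le> L * graph_norm_sq u0 u1"
      using \<open>L > 0\<close> damped_graph_norm_nonincreasing[OF w \<open>0 \<le> t\<close>] by (intro mult_left_mono) auto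
    also have "\<dots> \<le> L * (L * N1 u0 u1)"
      using \<open>L > 0\<close> sol(2) sol(6)[of 0] by (intro mult_left_mono upper) auto
    finally show ?thesis by (simp add: mult_ac)
  qed
  then show ?thesis using that[of "L * L"] \<open>L > 0\<close> by simp
qed

section \<open>Comparison with the weaker norm and with the undamped flow\<close>

lemma N0_le_N1:
  obtains c where "0 < c" "\<And>x y. x \<in> D \<Longrightarrow> y \<in> D' \<Longrightarrow> N0 x y \<le> c * N1 x y"
proof -
  obtain c where c: "0 < c" "\<And>x. x \<in> D' \<Longrightarrow> (norm x)\<^sup>2 \<le> c * (norm (S x))\<^sup>2"
    using bounded_inverse_S by metis
  have "N0 x y \<le> c * N1 x y" if "x \<in> D" "y \<in> D'" for x y
    using c(2)[of "S x"] c(2)[of y] that S_S[of x]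
    by (simp add: D_iff norm_sq_half_0_def norm_sq_1_half_def algebra_simps)
  then show ?thesis using that c(1) by blast
qed

text \<open>The difference of the two solutions starts at 0 and is driven by
  \<open>- B (Bs (w' t))\<close> alone. A Gronwall argument bounds its energy by the energy
  dissipated on \<open>{0..T}\<close>, and the observation of \<open>\<phi>'\<close> splits into
  those of \<open>w'\<close> and of the difference.\<close>

lemma observation_le_dissipation:
  assumes "0 < T"
  obtains P where "0 < P"
    "\<And>u0 u1 w w' \<phi> \<phi>'. damped u0 u1 w w' \<Longrightarrow> undamped u0 u1 \<phi> \<phi>' \<Longrightarrow>
      integral {0..T} (\<lambda>t. (norm (Bs (\<phi>' t)))\<^sup>2) \<le> P * (N0 (w 0) (w' 0) - N0 (w T) (w' T))"
proof -
  obtain b where b: "0 \<le> b" "\<And>x. norm (B x) \<le> b * norm x" "\<And>y. norm (Bs y) \<le> b * norm y"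
    using B_bounds by metis
  interpret Bs: bounded_linear Bs by (rule bounded_linear_adjoint[OF bl_B])
  \<comment> \<open>The 1 comes from the observation of \<open>w'\<close>, whose doubled integral is
    exactly the energy loss; the other term is the integral over \<open>{0..T}\<close> of the bound
    for the difference.\<close>
  define P where "P = 1 + T * (b^4 * exp T)"
  have "P > 0" unfolding P_def using \<open>0 < T\<close> b(1) by (simp add: add_pos_nonneg)
  moreover have "integral {0..T} (\<lambda>t. (norm (Bs (\<phi>' t)))\<^sup>2) \<le> P * (N0 (w 0) (w' 0) - N0 (w T) (w' T))"
    if w: "damped u0 u1 w w'" and phi: "undamped u0 u1 \<phi> \<phi>'" for u0 u1 w w' \<phi> \<phi>'
  proof -
    note sw = solutionD[OF w] and sp = solutionD[OF phi]
    define F where "F = (\<lambda>t. N0 (w t - \<phi> t) (w' t - \<phi>' t))"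
    define E where "E = (\<lambda>t. N0 (w t) (w' t))"
    define \<Delta> where "\<Delta> = E 0 - E T"
    have E_der: "(E has_real_derivative - 2 * (norm (Bs (w' t)))\<^sup>2) (at t within {0..})" if "0 \<le> t" for t
      unfolding E_def by (rule damped_energy_derivative[OF w that])
    have E_mono: "E t \<le> E s" if "0 \<le> s" "s \<le> t" for s t
      unfolding E_def by (rule damped_energy_nonincreasing[OF w that])
    have "0 \<le> \<Delta>" using E_mono[of 0 T] \<open>0 < T\<close> by (simp add: \<Delta>_def)
    define f where "f = (\<lambda>t. - B (Bs (w' t)))"
    have F_der: "(F has_real_derivative 2 * ((w' t - \<phi>' t) \<bullet> f t)) (at t within {0..})" if t: "0 \<le> t" for t
      unfolding F_def
    proof (rule energy_derivative)
      show "w t - \<phi> t \<in> D" "w' t - \<phi>' t \<in> D'"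
        using sw sp t by (auto simp: subspace_diff[OF subspace_D] subspace_diff[OF subspace_D'])
      have "((\<lambda>t. S (w t) - S (\<phi> t)) has_vector_derivative S (w' t) - S (\<phi>' t)) (at t within {0..})"
        by (intro has_vector_derivative_diff solution_S_derivative[OF w t] solution_S_derivative[OF phi t])
      then have "((\<lambda>t. S (w t - \<phi> t)) has_vector_derivative S (w' t) - S (\<phi>' t)) (at t within {0..})"
        by (rule has_vector_derivative_transform[rotated 2]) (use t sw sp in \<open>auto simp: S_diff D_iff\<close>)
      then show "((\<lambda>t. S (w t - \<phi> t)) has_vector_derivative S (w' t - \<phi>' t)) (at t within {0..})"
        using sw sp t by (simp add: S_diff)
      show "((\<lambda>t. w' t - \<phi>' t) has_vector_derivative - A (w t - \<phi> t) + f t) (at t within {0..})"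
        using has_vector_derivative_diff[OF sw(8)[OF t] sp(8)[OF t]] sw(5) sp(5) t
        by (simp add: A_diff f_def algebra_simps)
    qed
    have F_bound: "F t \<le> exp T * (b\<^sup>2 / 2 * \<Delta>)" if t: "0 \<le> t" "t \<le> T" for t
    proof -
      \<comment> \<open>Gronwall as a monotone quantity: \<open>F\<close> grows at rate at most
        \<open>F t + b\<^sup>2 * (norm (Bs (w' t)))\<^sup>2\<close>. The weight
        \<open>exp (- t)\<close> absorbs the first term, and the decrease of
        \<open>b\<^sup>2 / 2 * E t\<close> absorbs the second.\<close>
      have "exp (- t) * F t + b\<^sup>2 / 2 * E t \<le> exp (- 0) * F 0 + b\<^sup>2 / 2 * E 0"
      proof (rule nonincreasing_half_line[where f = "\<lambda>t. exp (- t) * F t + b\<^sup>2 / 2 * E t"])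
        fix t :: real assume t: "0 \<le> t"
        show "((\<lambda>t. exp (- t) * F t + b\<^sup>2 / 2 * E t) has_real_derivative
            exp (- t) * (2 * ((w' t - \<phi>' t) \<bullet> f t) - F t) - b\<^sup>2 * (norm (Bs (w' t)))\<^sup>2) (at t within {0..})"
          by (rule derivative_eq_intros F_der[OF t] E_der[OF t] refl)+ (simp add: algebra_simps)
        have "0 \<le> (norm ((w' t - \<phi>' t) - f t))\<^sup>2" by simp
        then have "2 * ((w' t - \<phi>' t) \<bullet> f t) \<le> (norm (w' t - \<phi>' t))\<^sup>2 + (norm (f t))\<^sup>2"
          unfolding power2_norm_eq_inner by (simp add: inner_simps inner_commute)
        moreover have "(norm (w' t - \<phi>' t))\<^sup>2 \<le> F t" by (simp add: F_def norm_sq_half_0_def)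
        moreover have "(norm (f t))\<^sup>2 \<le> (b * norm (Bs (w' t)))\<^sup>2"
          unfolding f_def norm_minus_cancel by (intro power_mono b) simp
        ultimately have "2 * ((w' t - \<phi>' t) \<bullet> f t) - F t \<le> b\<^sup>2 * (norm (Bs (w' t)))\<^sup>2"
          by (simp add: power_mult_distrib)
        then have "exp (- t) * (2 * ((w' t - \<phi>' t) \<bullet> f t) - F t) \<le> exp (- t) * (b\<^sup>2 * (norm (Bs (w' t)))\<^sup>2)"
          by (intro mult_left_mono) auto
        also have "\<dots> \<le> b\<^sup>2 * (norm (Bs (w' t)))\<^sup>2" using t by (intro mult_left_le_one_le) auto
        finally show "exp (- t) * (2 * ((w' t - \<phi>' t) \<bullet> f t) - F t) - b\<^sup>2 * (norm (Bs (w' t)))\<^sup>2 \<le> 0"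
          by simp
      qed (use t in auto)
      moreover have "F 0 = 0" using sw(1,2) sp(1,2) by (simp add: F_def norm_sq_half_0_def S_zero)
      moreover have "b\<^sup>2 / 2 * E T \<le> b\<^sup>2 / 2 * E t" using E_mono[OF t] by (intro mult_left_mono) auto
      ultimately have "exp (- t) * F t \<le> b\<^sup>2 / 2 * \<Delta>" by (simp add: \<Delta>_def algebra_simps)
      then have "F t \<le> exp t * (b\<^sup>2 / 2 * \<Delta>)" by (simp add: exp_minus field_simps)
      also have "\<dots> \<le> exp T * (b\<^sup>2 / 2 * \<Delta>)" using t \<open>0 \<le> \<Delta>\<close> by (intro mult_right_mono) auto
      finally show ?thesis .
    qed
    have "((\<lambda>t. - 2 * (norm (Bs (w' t)))\<^sup>2) has_integral E T - E 0) {0..T}"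
    proof (rule fundamental_theorem_of_calculus)
      fix t assume "t \<in> {0..T}"
      then show "(E has_vector_derivative - 2 * (norm (Bs (w' t)))\<^sup>2) (at t within {0..T})"
        using DERIV_subset[OF E_der, of t "{0..T}"]
        by (simp add: has_real_derivative_iff_has_vector_derivative subset_iff)
    qed (use \<open>0 < T\<close> in simp)
    from has_integral_neg[OF this]
    have int_w: "((\<lambda>t. 2 * (norm (Bs (w' t)))\<^sup>2) has_integral \<Delta>) {0..T}" by (simp add: \<Delta>_def)
    have int_bound: "((\<lambda>t. 2 * (norm (Bs (w' t)))\<^sup>2 + b^4 * exp T * \<Delta>) has_integral P * \<Delta>) {0..T}"
      using has_integral_add[OF int_w has_integral_const_real[of "b^4 * exp T * \<Delta>" 0 T]] \<open>0 < T\<close>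
      by (simp add: P_def algebra_simps)
    \<comment> \<open>Differentiability of \<open>\<phi>'\<close> makes the observation integrand
      continuous, hence integrable, as the comparison of integrals requires.\<close>
    have "continuous_on {0..T} \<phi>'"
      by (rule continuous_on_vector_derivative[where f' = "\<lambda>t. - A (\<phi> t)"])
        (use sp(8) in \<open>auto intro: has_vector_derivative_within_subset[of _ _ _ "{0..}"]\<close>)
    then have "continuous_on {0..T} (\<lambda>t. (norm (Bs (\<phi>' t)))\<^sup>2)"
      by (intro continuous_intros Bs.continuous_on)
    then have "((\<lambda>t. (norm (Bs (\<phi>' t)))\<^sup>2) has_integral
        integral {0..T} (\<lambda>t. (norm (Bs (\<phi>' t)))\<^sup>2)) {0..T}"
      by (intro integrable_integral integrable_continuous_interval)
    then have "integral {0..T} (\<lambda>t. (norm (Bs (\<phi>' t)))\<^sup>2) \<le> P * \<Delta>"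
    proof (rule has_integral_le[OF _ int_bound])
      fix t assume "t \<in> {0..T}"
      then have t: "0 \<le> t" "t \<le> T" by auto
      have "(norm (Bs (\<phi>' t)))\<^sup>2 \<le> 2 * (norm (Bs (w' t)))\<^sup>2 + 2 * (norm (Bs (w' t - \<phi>' t)))\<^sup>2"
        using norm_sq_add_le[of "Bs (w' t)" "- Bs (w' t - \<phi>' t)"]
        by (simp add: Bs.diff norm_minus_commute)
      moreover have "(norm (Bs (w' t - \<phi>' t)))\<^sup>2 \<le> (b * norm (w' t - \<phi>' t))\<^sup>2"
        by (intro power_mono b) simp
      moreover have "\<dots> \<le> b\<^sup>2 * F t"
        by (simp add: F_def norm_sq_half_0_def power_mult_distrib mult_left_mono)
      moreover have "\<dots> \<le> b\<^sup>2 * (exp T * (b\<^sup>2 / 2 * \<Delta>))" by (intro mult_left_mono F_bound t) simp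
      moreover have "\<dots> = b^4 * exp T * \<Delta> / 2" by (simp add: power2_eq_square power4_eq_xxxx)
      ultimately show "(norm (Bs (\<phi>' t)))\<^sup>2 \<le> 2 * (norm (Bs (w' t)))\<^sup>2 + b^4 * exp T * \<Delta>" by linarith
    qed
    then show ?thesis by (simp add: \<Delta>_def E_def)
  qed
  ultimately show ?thesis using that by blast
qed

end

section \<open>Decay by iteration over time windows of length T\<close>

theorem theorem6p1:
  fixes D D' :: "'h::{real_inner, complete_space} set"
    and A S :: "'h \<Rightarrow> 'h"
    and B :: "'u::{real_inner, complete_space} \<Rightarrow> 'h"
    and \<H> :: "real \<Rightarrow> real"
  assumes "self_adjoint D A" and "positive_operator D A" and "boundedly_invertible D A"
    and "positive_sqrt D A D' S"
    and "bounded_linear B"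
    and "well_posed D A D' S (\<lambda>x. 0)"
    and "well_posed D A D' S (\<lambda>x. B (adjoint B x))"
    and "continuous_on {0<..} \<H>" and "bij_betw \<H> {0<..} {0<..}" and "mono_on {0<..} \<H>"
    and "mono_on {0<..<1} (\<lambda>x. 1 / x * \<H> x)"
    and "\<exists>T>0. \<exists>C>0. \<forall>\<phi>0\<in>D. \<forall>\<phi>1\<in>D'. (\<phi>0, \<phi>1) \<noteq> (0, 0) \<longrightarrow>
           (\<forall>\<phi> \<phi>'. is_solution D A D' S (\<lambda>x. 0) \<phi>0 \<phi>1 \<phi> \<phi>' \<longrightarrow>
              integral {0..T} (\<lambda>t. (norm (adjoint B (\<phi>' t)))\<^sup>2)
                \<ge> C * norm_sq_1_half A S \<phi>0 \<phi>1
                    * \<H> (norm_sq_half_0 S \<phi>0 \<phi>1 / norm_sq_1_half A S \<phi>0 \<phi>1))"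
  shows "\<exists>C1>0. \<forall>t>0. \<forall>w0\<in>D. \<forall>w1\<in>D'. (w0, w1) \<noteq> (0, 0) \<longrightarrow>
           (\<forall>w w'. is_solution D A D' S (\<lambda>x. B (adjoint B x)) w0 w1 w w' \<longrightarrow>
              norm_sq_half_0 S (w t) (w' t)
                \<le> C1 * inv_into {0<..} \<H> (1 / (1 + t)) * norm_sq_1_half A S w0 w1)"
proof -
  interpret damped_system D D' A S B
    using assms(1,3,4,5) by (intro damped_system.intro) (simp_all add: self_adjoint_def)
  have H_pos: "0 < \<H> x" if "0 < x" for x using bij_betwE[OF assms(9)] that by auto
  note H_mono = assms(10) and ratio = assms(11)
  obtain T C where TC: "0 < T" "0 < C" and obs: "\<forall>\<phi>0\<in>D. \<forall>\<phi>1\<in>D'. (\<phi>0, \<phi>1) \<noteq> (0, 0) \<longrightarrow>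
      (\<forall>\<phi> \<phi>'. undamped \<phi>0 \<phi>1 \<phi> \<phi>' \<longrightarrow>
        C * N1 \<phi>0 \<phi>1 * \<H> (N0 \<phi>0 \<phi>1 / N1 \<phi>0 \<phi>1) \<le> integral {0..T} (\<lambda>t. (norm (Bs (\<phi>' t)))\<^sup>2))"
    using assms(12) by (elim exE conjE, intro that)
  obtain P where P: "0 < P" "\<And>u0 u1 w w' \<phi> \<phi>'. damped u0 u1 w w' \<Longrightarrow> undamped u0 u1 \<phi> \<phi>' \<Longrightarrow>
      integral {0..T} (\<lambda>t. (norm (Bs (\<phi>' t)))\<^sup>2) \<le> P * (N0 (w 0) (w' 0) - N0 (w T) (w' T))"
    using observation_le_dissipation[OF TC(1)] by metis
  obtain M where M: "0 < M"
    "\<And>u0 u1 u v t. damped u0 u1 u v \<Longrightarrow> 0 \<le> t \<Longrightarrow> N1 (u t) (v t) \<le> M * N1 u0 u1"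
    using N1_bounded by metis
  obtain c where c: "0 < c" "\<And>x y. x \<in> D \<Longrightarrow> y \<in> D' \<Longrightarrow> N0 x y \<le> c * N1 x y"
    using N0_le_N1 by metis
  \<comment> \<open>\<open>\<Gamma>\<close> is the loss in comparing ratios when the argument of
    \<open>\<H>\<close> is bounded by \<open>c\<close>, the bound for \<open>N0 / N1\<close>. In
    \<open>\<gamma>\<close>, division by \<open>P\<close> turns observation into dissipation and
    division by \<open>\<Gamma>\<close> pays for the change of normalisation.\<close>
  define \<Gamma> where "\<Gamma> = 1 + 2 * c"
  define \<gamma> where "\<gamma> = C / P / \<Gamma>"
  have pos: "0 < \<Gamma>" "0 < \<gamma>" using TC P c by (auto simp: \<Gamma>_def \<gamma>_def)
  \<comment> \<open>One window of length \<open>T\<close>. The normalisation \<open>Z\<close> only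
    has to dominate \<open>N1\<close> at its start, so a single \<open>Z\<close> will serve every
    window although \<open>N1\<close> varies.\<close>
  have decay: "N0 (w T) (w' T) / Z \<le> N0 w0 w1 / Z - \<gamma> * \<H> (N0 w0 w1 / Z)"
    if w: "damped w0 w1 w w'" and N0_pos: "0 < N0 w0 w1"
      and Z: "N1 w0 w1 \<le> Z" "N0 w0 w1 / Z \<le> 1/2" for w0 w1 w w' Z
  proof -
    have D: "w0 \<in> D" "w1 \<in> D'" using solutionD(1,2)[OF w] solutionD(5,6)[OF w, of 0] by auto
    have "0 < c * N1 w0 w1" using N0_pos c(2)[OF D] by linarith
    then have N1_pos: "0 < N1 w0 w1" using c(1) by (simp add: zero_less_mult_iff)
    have Z_pos: "0 < Z" using N1_pos Z(1) by linarith
    have nz: "(w0, w1) \<noteq> (0, 0)" using N0_pos by (auto simp: norm_sq_half_0_def S_zero)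
    obtain \<phi> \<phi>' where phi: "undamped w0 w1 \<phi> \<phi>'"
      using assms(6) D unfolding well_posed_def by blast
    define x where "x = N0 w0 w1 / N1 w0 w1"
    define y where "y = N0 w0 w1 / Z"
    have y_pos: "0 < y" using N0_pos Z_pos by (simp add: y_def)
    have "y \<le> x" using N0_pos N1_pos Z(1) unfolding x_def y_def by (intro divide_left_mono) auto
    moreover have "x \<le> c" using c(2)[OF D] N1_pos by (simp add: x_def field_simps)
    ultimately have "\<H> y / y \<le> \<Gamma> * (\<H> x / x)"
      unfolding \<Gamma>_def using y_pos Z(2)
      by (intro ratio_le_beyond_unit_interval[OF H_pos H_mono ratio]) (auto simp: y_def)
    \<comment> \<open>Multiplying by the energy turns the ratios into \<open>Z * \<H> y\<close> and
      \<open>N1 w0 w1 * \<H> x\<close>: this replaces the normalisation \<open>N1\<close> in the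
      observability estimate by \<open>Z\<close>.\<close>
    then have "\<H> y / y * N0 w0 w1 \<le> \<Gamma> * (\<H> x / x * N0 w0 w1)"
      unfolding mult.assoc[symmetric] using N0_pos by (intro mult_right_mono) auto
    moreover have "\<H> y / y * N0 w0 w1 = Z * \<H> y" using N0_pos Z_pos by (simp add: y_def)
    moreover have "\<H> x / x * N0 w0 w1 = N1 w0 w1 * \<H> x" using N0_pos N1_pos by (simp add: x_def)
    ultimately have "Z * \<H> y \<le> \<Gamma> * (N1 w0 w1 * \<H> x)" by metis
    then have "\<gamma> * (Z * \<H> y) \<le> \<gamma> * (\<Gamma> * (N1 w0 w1 * \<H> x))"
      using pos by (intro mult_left_mono) auto
    also have "\<dots> = C * N1 w0 w1 * \<H> x / P" using pos by (simp add: \<gamma>_def)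
    also have "\<dots> \<le> P * (N0 (w 0) (w' 0) - N0 (w T) (w' T)) / P"
      using obs[rule_format, OF D nz phi] P(2)[OF w phi] P(1) unfolding x_def
      by (intro divide_right_mono) auto
    also have "\<dots> = N0 w0 w1 - N0 (w T) (w' T)" using P(1) solutionD(1,2)[OF w] by simp
    finally have "N0 (w T) (w' T) \<le> N0 w0 w1 - \<gamma> * (Z * \<H> y)" by simp
    then have "N0 (w T) (w' T) / Z \<le> (N0 w0 w1 - \<gamma> * (Z * \<H> y)) / Z"
      using Z_pos by (intro divide_right_mono) auto
    then show ?thesis using Z_pos by (simp add: diff_divide_distrib y_def)
  qed
  \<comment> \<open>\<open>M\<close> makes \<open>Z\<close> dominate \<open>N1\<close> at all times,
    and \<open>2 * c\<close> makes the normalised energy start at 1/2 or below. In \<open>K\<close>,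
    the factor \<open>1 + T\<close> converts window counts to time, and the maximum with 1 is
    required for inverting \<open>\<H>\<close>.\<close>
  define M' where "M' = max M (2 * c)"
  define K where "K = max 1 (max (\<H> (1/2)) (1 / \<gamma>) * (1 + T))"
  have "0 < M'" "1 \<le> K" using M(1) by (auto simp: M'_def K_def)
  have "N0 (w t) (w' t) \<le> K * M' * inv_into {0<..} \<H> (1 / (1 + t)) * N1 w0 w1"
    if t: "0 < t" and w: "damped w0 w1 w w'" for t w0 w1 w w'
  proof -
    note sol = solutionD[OF w]
    define Z where "Z = M' * N1 w0 w1"
    define e where "e = (\<lambda>k. N0 (w (real k * T)) (w' (real k * T)) / Z)"
    \<comment> \<open>The number of complete windows up to \<open>t\<close>; the energy at
      \<open>t\<close> is at most that at the end of the last one.\<close>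
    define k where "k = nat \<lfloor>t / T\<rfloor>"
    define x where "x = inv_into {0<..} \<H> (1 / (1 + t))"
    have mem: "1 / (1 + t) \<in> \<H> ` {0<..}" using assms(9) t by (auto simp: bij_betw_def)
    have x: "0 < x" "\<H> x = 1 / (1 + t)"
      unfolding x_def using inv_into_into[OF mem] f_inv_into_f[OF mem] by simp_all
    have D: "w0 \<in> D" "w1 \<in> D'" using sol(1,2) sol(5,6)[of 0] by auto
    have N1_nonneg: "0 \<le> N1 w0 w1" by (simp add: norm_sq_1_half_def)
    have "0 \<le> t / T" using t TC by simp
    then have k: "real k \<le> t / T" "t / T < real k + 1" unfolding k_def by linarith+
    have kT: "real k * T \<le> t" "t < (real k + 1) * T"
      using k TC by (auto simp: field_simps)
    have le_k: "N0 (w t) (w' t) \<le> N0 (w (real k * T)) (w' (real k * T))"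
      by (rule damped_energy_nonincreasing[OF w]) (use kT TC in auto)
    show ?thesis
    \<comment> \<open>If the energy has vanished by \<open>k * T\<close>, it stays zero; otherwise
      \<open>e k\<close> is positive and \<open>\<H>\<close> can be evaluated there.\<close>
    proof (cases "0 < N0 (w (real k * T)) (w' (real k * T))")
      case False
      then have "N0 (w t) (w' t) \<le> 0" using le_k by simp
      also have "0 \<le> K * M' * x * N1 w0 w1"
        using \<open>0 < M'\<close> \<open>1 \<le> K\<close> x N1_nonneg by simp
      finally show ?thesis by (simp add: x_def)
    next
      case True
      have "N0 (w (real k * T)) (w' (real k * T)) \<le> N0 (w 0) (w' 0)"
        by (rule damped_energy_nonincreasing[OF w]) (use TC in auto)
      then have "0 < c * N1 w0 w1" using True c(2)[OF D] sol(1,2) by simp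
      then have N1_pos: "0 < N1 w0 w1" using c(1) by (simp add: zero_less_mult_iff)
      then have Z_pos: "0 < Z" using \<open>0 < M'\<close> by (simp add: Z_def)
      have e_decr: "e (Suc j) \<le> e j" for j
        unfolding e_def using Z_pos TC
        by (intro divide_right_mono damped_energy_nonincreasing[OF w]) auto
      have "2 * N0 w0 w1 \<le> Z"
      proof -
        have "2 * N0 w0 w1 \<le> (2 * c) * N1 w0 w1" using c(2)[OF D] by simp
        also have "\<dots> \<le> Z" unfolding Z_def using N1_nonneg by (intro mult_right_mono) (auto simp: M'_def)
        finally show ?thesis .
      qed
      then have e0: "e 0 \<le> 1/2" using Z_pos sol(1,2) by (simp add: e_def field_simps)
      have e_half: "e j \<le> 1/2" for j
        by (induction j) (use e0 e_decr order_trans in blast)+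
      \<comment> \<open>The solution restarted at \<open>j * T\<close> is again damped, and its
        initial \<open>N1\<close> is below \<open>Z\<close> by the uniform bound.\<close>
      have e_Suc: "e (Suc j) \<le> e j - \<gamma> * \<H> (e j)" if "0 < e j" for j
      proof -
        have jT: "0 \<le> real j * T" using TC by simp
        have "N1 (w (real j * T)) (w' (real j * T)) \<le> M * N1 w0 w1" by (rule M(2)[OF w jT])
        also have "\<dots> \<le> Z" unfolding Z_def using N1_nonneg by (intro mult_right_mono) (auto simp: M'_def)
        finally have "N1 (w (real j * T)) (w' (real j * T)) \<le> Z" .
        moreover have "0 < N0 (w (real j * T)) (w' (real j * T))"
          using that Z_pos by (simp add: e_def zero_less_divide_iff)
        ultimately have "N0 (w (T + real j * T)) (w' (T + real j * T)) / Z \<le> e j - \<gamma> * \<H> (e j)"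
          unfolding e_def using e_half[of j] by (intro decay[OF shift_solution[OF w jT]]) (auto simp: e_def)
        then show ?thesis by (simp add: e_def algebra_simps)
      qed
      have ek: "0 < e k" using True Z_pos by (simp add: e_def)
      have "\<H> (e k) \<le> max (\<H> (1/2)) (1 / \<gamma>) / (1 + real k)"
        by (rule decreasing_recursion_bound[OF H_pos H_mono ratio pos(2) e0 e_Suc e_decr ek])
      also have "\<dots> \<le> max (\<H> (1/2)) (1 / \<gamma>) * ((1 + T) / (1 + t))"
      proof -
        \<comment> \<open>Since \<open>t\<close> lies below \<open>(k + 1) * T\<close>, it suffices
          that 1 + (k + 1) T \<le> (1 + T)(1 + k).\<close>
        have "1 + t \<le> (1 + T) * (1 + real k)" using kT TC by (simp add: algebra_simps)
        then have "1 / (1 + real k) \<le> (1 + T) / (1 + t)" using t by (simp add: field_simps)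
        moreover have "0 \<le> max (\<H> (1/2)) (1 / \<gamma>)" using H_pos[of "1/2"] by simp
        ultimately show ?thesis by (metis mult_left_mono times_divide_eq_right mult.right_neutral)
      qed
      also have "\<dots> = max (\<H> (1/2)) (1 / \<gamma>) * (1 + T) * \<H> x" by (simp add: x)
      also have "\<dots> \<le> K * \<H> x"
        using H_pos[OF x(1)] by (intro mult_right_mono) (auto simp: K_def)
      finally have "\<H> (e k) \<le> K * \<H> x" .
      \<comment> \<open>As \<open>x\<close> is the preimage of \<open>1 / (1 + t)\<close>, passing
        from values of \<open>\<H>\<close> to arguments with the same \<open>K\<close> yields the
        decay rate.\<close>
      then have "e k \<le> K * x"
        by (rule le_mult_of_ratio_mono[OF H_pos ratio, rotated -1])
          (use e_half[of k] ek x \<open>1 \<le> K\<close> in auto)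
      then have "e k * Z \<le> K * x * Z" using Z_pos by (intro mult_right_mono) auto
      moreover have "e k * Z = N0 (w (real k * T)) (w' (real k * T))" using Z_pos by (simp add: e_def)
      ultimately show ?thesis using le_k by (simp add: Z_def x_def mult_ac)
    qed
  qed
  then show ?thesis using \<open>0 < M'\<close> \<open>1 \<le> K\<close> by (intro exI[of _ "K * M'"]) auto
qed

end
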